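(* Let $f(z)=z+z^2$ on $\mathbb{C}$, and let $\mathcal{A}=\mathcal{A}(0,-1)$ be the parabolic basin of attraction of $f$ at $0$ associated to the attraction vector $-1$. Let $C>0$ be an arbitrary constant and let $q=-\tfrac12\in\mathcal{A}$. Then there exists a point $z_0\in\mathcal{A}$ such that for every $$\tilde q\in Q:=\bigcup_{l,k=0}^{\infty} f^{-l}\big(f^{k}(-\tfrac12)\big)$$ the Kobayashi distance satisfies $d_{\mathcal{A}}(z_0,\tilde q)\ge C$.
   Context: $f^k$ denotes the $k$-fold iterate of $f$ and $f^{-l}(w)=\{z\in\mathbb{C}: f^l(z)=w\}$ (with $f^0=\mathrm{id}$). Parabolic basin: $\mathcal{A}=\mathcal{A}(0,-1)$ is the set of all $z_0\in\mathbb{C}$ whose orbit $z_k=f^k(z_0)$ converges to $0$ with no $z_k$ equal to $0$, and with $z_k\sim -1/k$ as $k\to\infty$ (i.e. $\lim_{k\to\infty} k z_k=-1$). Kobayashi metric and distance: let $\Delta$ be the open unit disk. For a domain $\Omega\subset\mathbb{C}$, $z\in\Omega$ and $\xi\in\mathbb{C}$, put $F_\Omega(z,\xi)=\inf\{\lambda>0:\ \exists\, g:\Delta\to\Omega \text{ holomorphic with } g(0)=z,\ \lambda g'(0)=\xi\}$. The length of a piecewise smooth curve $\gamma:[0,1]\to\Omega$ is $L_\Omega(\gamma)=\int_0^1F_\Omega(\gamma(t),\gamma'(t))\,dt$, and $d_\Omega(z_1,z_2)=\inf L_\Omega(\gamma)$ over piecewise smooth curves $\gamma$ in $\Omega$ joining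 $z_1$ to $z_2$. *)

theory Defs
  imports "HOL-Complex_Analysis.Complex_Analysis"
begin

definition parabolic_map :: "complex \<Rightarrow> complex" where
  "parabolic_map z = z + z\<^sup>2"

text \<open>The rate \<open>v/k\<close> is the one for a parabolic fixed point \<open>p\<close> of multiplicity two, for example
  the fixed point 0 of \<open>parabolic_map\<close>.\<close>

definition parabolic_basin :: "(complex \<Rightarrow> complex) \<Rightarrow> complex \<Rightarrow> complex \<Rightarrow> complex set" where
  "parabolic_basin h p v = {z.
      (\<lambda>k. (h ^^ k) z) \<longlonglongrightarrow> p \<and>
      (\<forall>k. (h ^^ k) z \<noteq> p) \<and>
      (\<lambda>k. of_nat k * ((h ^^ k) z - p)) \<longlonglongrightarrow> v}"

text \<open>Metric, length and distance take values in \<^typ>\<open>ennreal\<close>, so that an infimum over the empty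
  set is \<open>\<infinity>\<close> and the length integral is always defined.\<close>

definition kobayashi_metric :: "complex set \<Rightarrow> complex \<Rightarrow> complex \<Rightarrow> ennreal" where
  "kobayashi_metric \<Omega> z \<xi> = Inf {ennreal r | r. 0 < r \<and>
      (\<exists>g. g holomorphic_on ball 0 1 \<and> g ` ball 0 1 \<subseteq> \<Omega> \<and>
           g 0 = z \<and> complex_of_real r * deriv g 0 = \<xi>)}"

definition kobayashi_length :: "complex set \<Rightarrow> (real \<Rightarrow> complex) \<Rightarrow> ennreal" where
  "kobayashi_length \<Omega> \<gamma> =
     (\<integral>\<^sup>+ t\<in>{0..1}. kobayashi_metric \<Omega> (\<gamma> t) (vector_derivative \<gamma> (at t within {0..1})) \<partial>lborel)"

definition kobayashi_dist :: "complex set \<Rightarrow> complex \<Rightarrow> complex \<Rightarrow> ennreal" where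
  "kobayashi_dist \<Omega> z w = Inf {kobayashi_length \<Omega> \<gamma> | \<gamma>.
      valid_path \<gamma> \<and> path_image \<gamma> \<subseteq> \<Omega> \<and> pathstart \<gamma> = z \<and> pathfinish \<gamma> = w}"

end

theory Submission imports Defs "HOL-Real_Asymp.Real_Asymp"
begin

text \<open>The basin avoids \<open>[0, \<infinity>)\<close>, so \<open>W z = sqrt (- 1 / z)\<close> maps it into the right half-plane
  and cannot increase Kobayashi distance. In the coordinate \<open>u = - 1 / z\<close>, orbits starting
  sufficiently far above the real axis stay in the upper half-plane and converge to the fixed
  point. The horodisc of such points therefore lies in the basin and misses the grand orbit of
  \<open>- 1 / 2\<close>, whose forward orbit is real. In the \<open>W\<close>-plane this horodisc contains
  \<open>{x + i y. x y \<ge> const}\<close>, which contains hyperbolic balls of arbitrary radius around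
  \<open>1 + i b\<close> as \<open>b \<rightarrow> \<infinity>\<close>.\<close>

section \<open>The Kobayashi metric and maps to the right half-plane\<close>

text \<open>Schwarz-Pick for the right half-plane: the Cayley transform \<open>h\<close> carries
  \<open>g 0\<close> to the centre of the disc, so the Schwarz lemma applies to it. The norm of
  \<open>a + cnj a\<close> in \<open>deriv h 0\<close> produces the factor
  \<open>2 * Re (g 0)\<close>.\<close>

lemma norm_deriv_half_plane:
  assumes g: "g holomorphic_on ball 0 1" and pos: "\<And>w. w \<in> ball 0 1 \<Longrightarrow> 0 < Re (g w)"
  shows "norm (deriv g 0) \<le> 2 * Re (g 0)"
proof -
  define a where "a = g 0"
  define h where "h w = (g w - a) / (g w + cnj a)" for w
  have a: "0 < Re a" using pos[of 0] by (simp add: a_def)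
  have nz: "g w + cnj a \<noteq> 0" if "w \<in> ball 0 1" for w
    using pos[OF that] a by (auto simp: complex_eq_iff)
  have h: "h holomorphic_on ball 0 1"
    unfolding h_def using nz by (intro holomorphic_intros g) auto
  have "norm (h w) < 1" if "norm w < 1" for w
  proof -
    have w: "w \<in> ball 0 1" using that by simp
    have "(norm (g w - a))\<^sup>2 < (norm (g w + cnj a))\<^sup>2"
      using mult_pos_pos[OF pos[OF w] a]
      by (simp add: cmod_power2) (simp add: power2_eq_square algebra_simps)
    then have "norm (g w - a) < norm (g w + cnj a)"
      by (rule power_less_imp_less_base) simp
    then show ?thesis
      using nz[OF w] by (simp add: h_def norm_divide)
  qed
  moreover have "h 0 = 0" by (simp add: h_def a_def)
  ultimately have "norm (deriv h 0) \<le> 1"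
    using Schwarz_Lemma(2)[OF h, of 0] by simp
  moreover have "deriv h 0 = deriv g 0 / (a + cnj a)"
  proof (rule DERIV_imp_deriv)
    have "(g has_field_derivative deriv g 0) (at 0)"
      using g by (rule holomorphic_derivI) auto
    then have "((\<lambda>w. g w - a) has_field_derivative deriv g 0) (at 0)"
      "((\<lambda>w. g w + cnj a) has_field_derivative deriv g 0) (at 0)"
      by (auto intro!: derivative_eq_intros)
    from DERIV_divide[OF this] show "(h has_field_derivative deriv g 0 / (a + cnj a)) (at 0)"
      unfolding h_def using nz[of 0] by (simp add: a_def)
  qed
  moreover have "norm (a + cnj a) = 2 * Re a"
    using a by (simp add: complex_add_cnj)
  ultimately show ?thesis
    using a by (simp add: norm_divide a_def)
qed

text \<open>Composing a competing disc \<open>g\<close> with \<open>W\<close> gives a disc in the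
  half-plane, where Schwarz-Pick bounds \<open>r\<close> from below. Asking for \<open>W\<close> on
  an open superset \<open>U\<close> lets the basin be inserted for \<open>\<Omega>\<close> without a
  proof that the basin is open.\<close>

lemma kobayashi_metric_ge_half_plane:
  assumes W: "W holomorphic_on U" "open U" and "\<Omega> \<subseteq> U" "z \<in> \<Omega>"
    and pos: "\<And>w. w \<in> U \<Longrightarrow> 0 < Re (W w)"
  shows "ennreal (norm (deriv W z * \<xi>) / (2 * Re (W z))) \<le> kobayashi_metric \<Omega> z \<xi>"
  unfolding kobayashi_metric_def
proof (rule Inf_greatest, clarify)
  fix r g
  assume r: "0 < (r::real)" and g: "g holomorphic_on ball 0 1" "g ` ball 0 1 \<subseteq> \<Omega>" "z = g 0"
  have z: "0 < Re (W (g 0))" and gU: "g 0 \<in> U" using assms g by auto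
  have "(W \<circ> g) holomorphic_on ball 0 1"
    using g W assms(3) by (intro holomorphic_on_compose_gen[of g _ W U]) blast+
  moreover have "0 < Re ((W \<circ> g) w)" if "w \<in> ball 0 1" for w
    unfolding o_def using g(2) assms(3) that by (intro pos) blast
  ultimately have "norm (deriv (W \<circ> g) 0) \<le> 2 * Re ((W \<circ> g) 0)"
    by (rule norm_deriv_half_plane)
  moreover have "deriv (W \<circ> g) 0 = deriv W (g 0) * deriv g 0"
    by (rule deriv_chain)
      (use g W gU in \<open>auto intro: holomorphic_on_imp_differentiable_at\<close>)
  ultimately have "norm (deriv W (g 0) * deriv g 0) \<le> 2 * Re (W (g 0))" by simp
  then have "r * norm (deriv W (g 0) * deriv g 0) \<le> r * (2 * Re (W (g 0)))"
    using r by (intro mult_left_mono) auto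
  then have "norm (deriv W (g 0) * (of_real r * deriv g 0)) / (2 * Re (W (g 0))) \<le> r"
    using r z by (simp add: norm_mult field_simps)
  then show "ennreal (norm (deriv W (g 0) * (of_real r * deriv g 0)) / (2 * Re (W (g 0)))) \<le> ennreal r"
    by (rule ennreal_leI)
qed

text \<open>No measurability of \<open>\<phi>\<close> is assumed: its integral is then a lower integral, which still
  dominates the integral of the measurable minorant \<open>\<bar>h'\<bar>\<close>. Since \<open>h'\<close> may be unbounded near
  \<open>S\<close>, its integrability has to be deduced from the bound on this integral.\<close>

lemma increment_le_nn_integral:
  fixes h h' \<phi> :: "real \<Rightarrow> real"
  assumes S: "finite S" and h: "continuous_on {0..1} h"
    and deriv: "\<And>t. t \<in> {0..1} - S \<Longrightarrow> (h has_vector_derivative h' t) (at t)"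
    and h': "continuous_on ({0..1} - S) h'"
    and le: "\<And>t. t \<in> {0..1} - S \<Longrightarrow> \<bar>h' t\<bar> \<le> \<phi> t"
    and C: "(\<integral>\<^sup>+ t\<in>{0..1}. ennreal (\<phi> t) \<partial>lborel) \<le> ennreal C" "0 \<le> C"
    and s: "s \<in> {0..1}"
  shows "\<bar>h s - h 0\<bar> \<le> C"
proof -
  define g where "g t = indicator ({0..s} - S) t *\<^sub>R h' t" for t
  have [measurable]: "g \<in> borel_measurable borel"
    unfolding g_def using s S
    by (intro borel_measurable_continuous_on_indicator continuous_on_subset[OF h'])
      (auto intro: borel_closed finite_imp_closed)
  have "(\<integral>\<^sup>+ t. ennreal (norm (g t)) \<partial>lborel) \<le> (\<integral>\<^sup>+ t\<in>{0..1}. ennreal (\<phi> t) \<partial>lborel)"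
    using s by (intro nn_integral_mono) (auto simp: g_def indicator_def intro!: ennreal_leI le)
  also note C(1)
  finally have gC: "(\<integral>\<^sup>+ t. ennreal (norm (g t)) \<partial>lborel) \<le> ennreal C" .
  then have int: "integrable lborel g"
    by (intro integrableI_bounded) (auto intro: le_less_trans)
  have "(h' has_integral h s - h 0) {0..s}"
    using s S by (intro fundamental_theorem_of_calculus_interior_strong[of S])
      (auto intro!: deriv intro: continuous_on_subset[OF h])
  then have "((\<lambda>t. if t \<in> {0..s} then h' t else 0) has_integral h s - h 0) UNIV"
    by (simp only: has_integral_restrict_UNIV)
  then have "(g has_integral h s - h 0) UNIV"
    by (rule has_integral_spike_finite[OF S, rotated]) (auto simp: g_def indicator_def)
  then have "h s - h 0 = integral\<^sup>L lborel g"
    using has_integral_integral_lborel[OF int] by (rule has_integral_unique)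
  then have "ennreal \<bar>h s - h 0\<bar> \<le> ennreal C"
    using integral_norm_bound_ennreal[OF int] gC by simp
  then show ?thesis using C(2) by simp
qed

text \<open>For the density \<open>1 / (2 * Re w)\<close> the function \<open>ln (Re w) / 2\<close>
  is 1-Lipschitz, so \<open>Re\<close> changes by a factor of at most \<open>exp (2 * C)\<close>
  anywhere along the path. Hence \<open>Re\<close> stays below \<open>R\<close>, the density is at
  least \<open>1 / (2 * R)\<close> on the whole path, and \<open>Im w / (2 * R)\<close> changes by
  at most \<open>C\<close>.\<close>

lemma half_plane_path_endpoint:
  fixes \<omega> \<omega>' :: "real \<Rightarrow> complex"
  assumes S: "finite S" and \<omega>: "continuous_on {0..1} \<omega>"
    and deriv: "\<And>t. t \<in> {0..1} - S \<Longrightarrow> (\<omega> has_vector_derivative \<omega>' t) (at t)"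
    and \<omega>': "continuous_on ({0..1} - S) \<omega>'"
    and pos: "\<And>t. t \<in> {0..1} \<Longrightarrow> 0 < Re (\<omega> t)"
    and C: "(\<integral>\<^sup>+ t\<in>{0..1}. ennreal (norm (\<omega>' t) / (2 * Re (\<omega> t))) \<partial>lborel) \<le> ennreal C" "0 \<le> C"
  shows "Re (\<omega> 0) * exp (- 2 * C) \<le> Re (\<omega> 1)"
    and "\<bar>Im (\<omega> 1) - Im (\<omega> 0)\<bar> \<le> 2 * C * Re (\<omega> 0) * exp (2 * C)"
proof -
  define R where "R = Re (\<omega> 0) * exp (2 * C)"
  have pos0: "0 < Re (\<omega> 0)" using pos[of 0] by simp
  have R: "0 < R" using pos0 by (simp add: R_def)
  have Re': "((\<lambda>t. Re (\<omega> t)) has_vector_derivative Re (\<omega>' t)) (at t)"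
    and Im': "((\<lambda>t. Im (\<omega> t)) has_vector_derivative Im (\<omega>' t)) (at t)"
    if "t \<in> {0..1} - S" for t
    using deriv[OF that]
    by (auto intro: bounded_linear.has_vector_derivative bounded_linear_Re bounded_linear_Im)
  have log: "\<bar>ln (Re (\<omega> s)) / 2 - ln (Re (\<omega> 0)) / 2\<bar> \<le> C" if s: "s \<in> {0..1}" for s
  proof (rule increment_le_nn_integral[OF S _ _ _ _ C s])
    show "continuous_on {0..1} (\<lambda>t. ln (Re (\<omega> t)) / 2)"
      using pos by (intro continuous_intros \<omega>) force+
    show "((\<lambda>t. ln (Re (\<omega> t)) / 2) has_vector_derivative Re (\<omega>' t) / (2 * Re (\<omega> t))) (at t)"
      if "t \<in> {0..1} - S" for t
    proof -
      have "0 < Re (\<omega> t)" using that by (intro pos) auto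
      then have "((\<lambda>t. ln (Re (\<omega> t)) / 2) has_real_derivative 1 / Re (\<omega> t) * Re (\<omega>' t) / 2) (at t)"
        using Re'[OF that] unfolding has_real_derivative_iff_has_vector_derivative[symmetric]
        by (intro DERIV_cdivide DERIV_chain2[OF DERIV_ln_divide])
      then show ?thesis
        by (simp add: has_real_derivative_iff_has_vector_derivative mult.commute)
    qed
    show "continuous_on ({0..1} - S) (\<lambda>t. Re (\<omega>' t) / (2 * Re (\<omega> t)))"
      using pos by (intro continuous_intros \<omega>' continuous_on_subset[OF \<omega>]) force+
    show "\<bar>Re (\<omega>' t) / (2 * Re (\<omega> t))\<bar> \<le> norm (\<omega>' t) / (2 * Re (\<omega> t))"
      if "t \<in> {0..1} - S" for t
      using pos[of t] that abs_Re_le_cmod[of "\<omega>' t"] by (simp add: divide_right_mono)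
  qed
  have upper: "Re (\<omega> s) \<le> R" and lower: "Re (\<omega> 0) * exp (- 2 * C) \<le> Re (\<omega> s)"
    if s: "s \<in> {0..1}" for s
  proof -
    have "ln (Re (\<omega> s)) \<le> ln (Re (\<omega> 0)) + 2 * C" "ln (Re (\<omega> 0)) - 2 * C \<le> ln (Re (\<omega> s))"
      using log[OF s] by (simp_all add: abs_le_iff)
    then have "exp (ln (Re (\<omega> s))) \<le> exp (ln (Re (\<omega> 0)) + 2 * C)"
      "exp (ln (Re (\<omega> 0)) + - 2 * C) \<le> exp (ln (Re (\<omega> s)))"
      by simp_all
    then show "Re (\<omega> s) \<le> R" "Re (\<omega> 0) * exp (- 2 * C) \<le> Re (\<omega> s)"
      using pos[OF s] pos0 unfolding exp_add by (simp_all add: R_def)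
  qed
  show "Re (\<omega> 0) * exp (- 2 * C) \<le> Re (\<omega> 1)" using lower[of 1] by simp
  have "\<bar>Im (\<omega> 1) / (2 * R) - Im (\<omega> 0) / (2 * R)\<bar> \<le> C"
  proof (rule increment_le_nn_integral[OF S _ _ _ _ C])
    show "continuous_on {0..1} (\<lambda>t. Im (\<omega> t) / (2 * R))"
      using R by (intro continuous_intros \<omega>) auto
    show "((\<lambda>t. Im (\<omega> t) / (2 * R)) has_vector_derivative Im (\<omega>' t) / (2 * R)) (at t)"
      if "t \<in> {0..1} - S" for t
      using Im'[OF that] unfolding has_real_derivative_iff_has_vector_derivative[symmetric]
      by (rule DERIV_cdivide)
    show "continuous_on ({0..1} - S) (\<lambda>t. Im (\<omega>' t) / (2 * R))"
      using R by (intro continuous_intros \<omega>') auto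
    show "\<bar>Im (\<omega>' t) / (2 * R)\<bar> \<le> norm (\<omega>' t) / (2 * Re (\<omega> t))"
      if "t \<in> {0..1} - S" for t
      using pos[of t] that abs_Im_le_cmod[of "\<omega>' t"] R upper[of t]
      by (auto intro!: frac_le)
  qed simp
  then have "\<bar>(Im (\<omega> 1) - Im (\<omega> 0)) / (2 * R)\<bar> \<le> C" by (simp add: diff_divide_distrib)
  then show "\<bar>Im (\<omega> 1) - Im (\<omega> 0)\<bar> \<le> 2 * C * Re (\<omega> 0) * exp (2 * C)"
    using R by (simp add: field_simps R_def)
qed

text \<open>The two coordinate bounds confine \<open>W q\<close> to an explicit region around
  \<open>W z\<close> and take the place of a formula for the hyperbolic distance. They come from
  pushing a path of length less than \<open>C\<close> forward by \<open>W\<close>.\<close>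

lemma kobayashi_dist_half_plane:
  assumes W: "W holomorphic_on U" "open U" and "\<Omega> \<subseteq> U"
    and pos: "\<And>w. w \<in> U \<Longrightarrow> 0 < Re (W w)"
    and dist: "kobayashi_dist \<Omega> z q < ennreal C" and C: "0 < C"
  shows "Re (W z) * exp (- 2 * C) \<le> Re (W q)"
    and "\<bar>Im (W q) - Im (W z)\<bar> \<le> 2 * C * Re (W z) * exp (2 * C)"
proof -
  obtain \<gamma> where \<gamma>: "valid_path \<gamma>" "path_image \<gamma> \<subseteq> \<Omega>" "\<gamma> 0 = z" "\<gamma> 1 = q"
    and len: "kobayashi_length \<Omega> \<gamma> < ennreal C"
    using dist unfolding kobayashi_dist_def Inf_less_iff
    by (auto simp: pathstart_def pathfinish_def)
  obtain S where cont: "continuous_on {0..1} \<gamma>" and S: "finite S" "\<gamma> C1_differentiable_on ({0..1} - S)"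
    using \<gamma>(1) unfolding valid_path_def piecewise_C1_differentiable_on_def by blast
  have in\<Omega>: "\<gamma> t \<in> \<Omega>" if "t \<in> {0..1}" for t
    using \<gamma>(2) that by (auto simp: path_image_def)
  obtain D where D: "\<And>t. t \<in> {0..1} - S \<Longrightarrow> (\<gamma> has_vector_derivative D t) (at t)"
    and contD: "continuous_on ({0..1} - S) D"
    using S(2) unfolding C1_differentiable_on_def by blast
  define \<omega>' where "\<omega>' t = deriv W (\<gamma> t) * D t" for t
  have \<omega>: "continuous_on {0..1} (\<lambda>t. W (\<gamma> t))"
    using in\<Omega> assms
    by (intro continuous_on_compose2[OF holomorphic_on_imp_continuous_on[OF W(1)] cont]) auto
  have \<omega>': "continuous_on ({0..1} - S) \<omega>'"
    unfolding \<omega>'_def using in\<Omega> assms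
    by (intro continuous_intros contD continuous_on_compose2[OF holomorphic_on_imp_continuous_on[OF holomorphic_deriv[OF W]]]
       continuous_on_subset[OF cont]) blast+
  have deriv: "((\<lambda>t. W (\<gamma> t)) has_vector_derivative \<omega>' t) (at t)" if "t \<in> {0..1} - S" for t
  proof -
    have "(W has_field_derivative deriv W (\<gamma> t)) (at (\<gamma> t))"
      using W in\<Omega>[of t] that assms(3) by (intro holomorphic_derivI[of _ U]) auto
    from field_vector_diff_chain_at[OF D[OF that] this] show ?thesis
      by (simp add: o_def \<omega>'_def mult.commute)
  qed
  \<comment> \<open>The derivative in \<open>kobayashi_length\<close> is taken within
    \<open>{0..1}\<close>. It agrees with \<open>D\<close> off the breakpoints, which form a null
    set.\<close>
  have "AE t in lborel. t \<notin> S"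
    using S(1) by (intro AE_not_in) (auto intro: finite_imp_null_set_lborel)
  then have "(\<integral>\<^sup>+ t\<in>{0..1}. ennreal (norm (\<omega>' t) / (2 * Re (W (\<gamma> t)))) \<partial>lborel) \<le> kobayashi_length \<Omega> \<gamma>"
    unfolding kobayashi_length_def
  proof (intro nn_integral_mono_AE, eventually_elim)
    case (elim t)
    show ?case
    proof (cases "t \<in> {0..1}")
      case True
      have "vector_derivative \<gamma> (at t within {0..1}) = D t"
        using D elim True by (intro vector_derivative_at_within_ivl) auto
      then show ?thesis
        using kobayashi_metric_ge_half_plane[OF W assms(3) in\<Omega>[OF True] pos, where \<xi>="D t"] True
        by (simp add: \<omega>'_def)
    qed simp
  qed
  with len have le: "(\<integral>\<^sup>+ t\<in>{0..1}. ennreal (norm (\<omega>' t) / (2 * Re (W (\<gamma> t)))) \<partial>lborel) \<le> ennreal C"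
    by simp
  note * = half_plane_path_endpoint[OF S(1) \<omega> deriv \<omega>' _ le]
  show "Re (W z) * exp (- 2 * C) \<le> Re (W q)"
    "\<bar>Im (W q) - Im (W z)\<bar> \<le> 2 * C * Re (W z) * exp (2 * C)"
    using * pos in\<Omega> assms(3) C \<gamma>(3,4) by auto
qed

section \<open>The parabolic basin of \<open>z + z\<^sup>2\<close>\<close>

text \<open>From some index \<open>N\<close> on, the deviation from linear growth increases by less
  than \<open>e / 2\<close> per step, and the deviation present at \<open>N\<close> disappears after
  division by a large \<open>n\<close>. This turns a limiting step size into the rate demanded by
  the basin.\<close>

lemma Cesaro_increments:
  fixes a :: "nat \<Rightarrow> 'a::real_normed_vector"
  assumes "(\<lambda>n. a (Suc n) - a n) \<longlonglongrightarrow> L"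
  shows "(\<lambda>n. a n /\<^sub>R real n) \<longlonglongrightarrow> L"
proof (rule LIMSEQ_I)
  fix e :: real assume e: "0 < e"
  obtain N where N: "\<And>n. n \<ge> N \<Longrightarrow> norm (a (Suc n) - a n - L) < e / 2"
    using LIMSEQ_D[OF assms, of "e/2"] e by auto
  have bound: "norm (a n - real n *\<^sub>R L) \<le> norm (a N - real N *\<^sub>R L) + real n * (e / 2)" if "n \<ge> N" for n
    using that
  proof (induction n rule: dec_induct)
    case base
    then show ?case using e by simp
  next
    case (step n)
    have "a (Suc n) - real (Suc n) *\<^sub>R L = (a n - real n *\<^sub>R L) + (a (Suc n) - a n - L)"
      by (simp add: algebra_simps)
    then have "norm (a (Suc n) - real (Suc n) *\<^sub>R L) \<le> norm (a n - real n *\<^sub>R L) + norm (a (Suc n) - a n - L)"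
      by (metis norm_triangle_ineq)
    also have "\<dots> \<le> norm (a N - real N *\<^sub>R L) + real n * (e / 2) + e / 2"
      using step.IH N[of n] step.hyps by simp
    finally show ?case by (simp add: field_simps)
  qed
  obtain M where M: "real M > 2 * norm (a N - real N *\<^sub>R L) / e"
    using reals_Archimedean2 by blast
  show "\<exists>M. \<forall>n\<ge>M. norm (a n /\<^sub>R real n - L) < e"
  proof (intro exI allI impI)
    fix n assume n: "n \<ge> max (Suc N) M"
    then have n0: "real n > 0" and "real M \<le> real n" by auto
    then have "norm (a N - real N *\<^sub>R L) < real n * (e / 2)"
      using M e less_le_trans[of "2 * norm (a N - real N *\<^sub>R L)" "real M * e" "real n * e"]
      by (simp add: divide_less_eq)
    with bound[of n] n have "norm (a n - real n *\<^sub>R L) < real n * e"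
      by simp
    moreover have "a n /\<^sub>R real n - L = (a n - real n *\<^sub>R L) /\<^sub>R real n"
      using n0 by (simp add: algebra_simps)
    ultimately show "norm (a n /\<^sub>R real n - L) < e"
      using n0 by (simp add: divide_less_eq mult.commute flip: divide_inverse_commute)
  qed
qed

lemma parabolic_map_inverse_coordinate:
  assumes "z \<noteq> 0" "parabolic_map z \<noteq> 0"
  shows "- 1 / parabolic_map z = - 1 / z + 1 / (1 + z)"
proof -
  have "parabolic_map z = z * (1 + z)"
    by (simp add: parabolic_map_def power2_eq_square algebra_simps)
  moreover from this assms have "1 + z \<noteq> 0" by auto
  ultimately show ?thesis using assms by (simp add: field_simps)
qed

text \<open>A drift of \<open>1 / 2\<close> in \<open>Re u\<close>, where
  \<open>u = - 1 / z\<close>, already forces \<open>u\<close> to infinity and the orbit to 0. The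
  exact increments \<open>1 / (1 + z)\<close> of \<open>u\<close> then tend to 1, so
  \<open>u\<close> grows like \<open>k\<close>, and inverting gives the rate.\<close>

lemma in_parabolic_basin:
  assumes nz: "\<And>k. (parabolic_map ^^ k) z \<noteq> 0"
    and step: "\<And>k. Re (- 1 / (parabolic_map ^^ k) z) + 1 / 2 \<le> Re (- 1 / (parabolic_map ^^ Suc k) z)"
  shows "z \<in> parabolic_basin parabolic_map 0 (- 1)"
proof -
  define a where "a k = - 1 / (parabolic_map ^^ k) z" for k
  have orb: "(parabolic_map ^^ k) z = - 1 / a k" for k
    using nz[of k] by (simp add: a_def)
  have growth: "Re (a 0) + real k / 2 \<le> Re (a k)" for k
  proof (induction k)
    case (Suc k)
    have "Re (a k) + 1 / 2 \<le> Re (a (Suc k))" using step[of k] by (simp only: a_def)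
    moreover have "real (Suc k) / 2 = real k / 2 + 1 / 2" by (simp add: field_simps)
    ultimately show ?case using Suc by linarith
  qed simp
  have "filterlim (\<lambda>k. Re (a 0) + real k / 2) at_top sequentially" by real_asymp
  then have "filterlim (\<lambda>k. Re (a k)) at_top sequentially"
    by (rule filterlim_at_top_mono) (use growth in auto)
  then have "filterlim (\<lambda>k. norm (a k)) at_top sequentially"
    by (rule filterlim_at_top_mono) (auto intro!: always_eventually complex_Re_le_cmod)
  then have "filterlim a at_infinity sequentially"
    by (simp add: filterlim_at_infinity_conv_norm_at_top)
  then have lim0: "(\<lambda>k. (parabolic_map ^^ k) z) \<longlonglongrightarrow> 0"
    unfolding orb by (intro tendsto_divide_0[OF tendsto_const])
  then have "(\<lambda>k. 1 / (1 + (parabolic_map ^^ k) z)) \<longlonglongrightarrow> 1 / (1 + 0)"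
    by (intro tendsto_intros) auto
  moreover have "a (Suc k) - a k = 1 / (1 + (parabolic_map ^^ k) z)" for k
    using parabolic_map_inverse_coordinate[of "(parabolic_map ^^ k) z"] nz[of k] nz[of "Suc k"]
    by (simp add: a_def)
  ultimately have "(\<lambda>k. a k /\<^sub>R real k) \<longlonglongrightarrow> 1"
    by (intro Cesaro_increments) simp
  then have "(\<lambda>k. - inverse (a k /\<^sub>R real k)) \<longlonglongrightarrow> - inverse 1"
    by (intro tendsto_intros) auto
  moreover have "- inverse (a k /\<^sub>R real k) = of_nat k * ((parabolic_map ^^ k) z - 0)" for k
    by (simp add: a_def scaleR_conv_of_real field_simps)
  ultimately show ?thesis
    using lim0 nz by (simp add: parabolic_basin_def)
qed

text \<open>The interval is invariant because \<open>y * (1 + y)\<close> lies between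
  \<open>y\<close> and 0. That the forward orbit of \<open>- 1 / 2\<close> is real later separates
  its grand orbit from the horodisc.\<close>

lemma parabolic_orbit_real:
  assumes "x \<in> {- 1 / 2..<0::real}"
  shows "\<exists>y \<in> {- 1 / 2..<0}. (parabolic_map ^^ k) (of_real x) = of_real y"
proof (induction k)
  case (Suc k)
  then obtain y where y: "y \<in> {- 1 / 2..<0}" "(parabolic_map ^^ k) (of_real x) = of_real y" by blast
  have "y + y\<^sup>2 = y * (1 + y)" by (simp add: power2_eq_square algebra_simps)
  also have "\<dots> < 0" using y by (auto simp: mult_less_0_iff)
  finally have "y + y\<^sup>2 \<in> {- 1 / 2..<0}" using y by (auto intro: add_increasing2)
  then show ?case using y by (intro bexI[of _ "y + y\<^sup>2"]) (simp_all add: parabolic_map_def[of "of_real y"])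
qed (use assms in auto)

lemma minus_half_in_basin: "- (1 / 2) \<in> parabolic_basin parabolic_map 0 (- 1)"
proof (rule in_parabolic_basin)
  fix k
  obtain y where y: "y \<in> {- 1 / 2..<0}" "(parabolic_map ^^ k) (- (1/2)) = of_real y"
    using parabolic_orbit_real[of "- 1 / 2" k] by auto
  show "(parabolic_map ^^ k) (- (1/2)) \<noteq> 0" using y by auto
  obtain y' where y': "y' \<in> {- 1 / 2..<0}" "(parabolic_map ^^ Suc k) (- (1/2)) = of_real y'"
    using parabolic_orbit_real[of "- 1 / 2" "Suc k"] by auto
  have "- 1 / complex_of_real y' = - 1 / of_real y + 1 / (1 + of_real y)"
    using parabolic_map_inverse_coordinate[of "of_real y"] y y' by simp
  then have "complex_of_real (- 1 / y') = of_real (- 1 / y + 1 / (1 + y))" by simp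
  then have "- 1 / y' = - 1 / y + 1 / (1 + y)" unfolding of_real_eq_iff .
  moreover have "1 / 2 \<le> 1 / (1 + y)" using y by (auto simp: field_simps)
  moreover have "Re (- 1 / of_real r) = - 1 / r" for r
    by (metis Re_complex_of_real of_real_1 of_real_divide of_real_minus)
  ultimately show "Re (- 1 / (parabolic_map ^^ k) (- (1/2))) + 1 / 2
      \<le> Re (- 1 / (parabolic_map ^^ Suc k) (- (1/2)))"
    unfolding y(2) y'(2) by simp
qed

text \<open>Orbits of nonnegative reals stay nonnegative, which contradicts convergence of
  \<open>k\<close> times the orbit to \<open>- 1\<close>. On the complement of this ray a branch of
  \<open>sqrt (- 1 / z)\<close> exists.\<close>

lemma parabolic_basin_avoids_nonneg:
  assumes "z \<in> parabolic_basin parabolic_map 0 (- 1)"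
  shows "z \<notin> \<real>\<^sub>\<ge>\<^sub>0"
proof
  assume "z \<in> \<real>\<^sub>\<ge>\<^sub>0"
  then have orb: "(parabolic_map ^^ k) z \<in> \<real>\<^sub>\<ge>\<^sub>0" for k
    by (induction k) (auto simp: parabolic_map_def intro!: nonneg_Reals_add_I nonneg_Reals_pow_I)
  have "(\<lambda>k. Re (of_nat k * ((parabolic_map ^^ k) z - 0))) \<longlonglongrightarrow> Re (- 1)"
    using assms unfolding parabolic_basin_def by (intro tendsto_Re) auto
  moreover have "0 \<le> Re (of_nat k * ((parabolic_map ^^ k) z - 0))" for k
    using orb[of k] by (auto simp: complex_nonneg_Reals_iff)
  ultimately have "0 \<le> Re (- 1)" by (intro LIMSEQ_le_const[of _ _ 0]) auto
  then show False by simp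
qed

section \<open>A horodisc inside the basin\<close>

text \<open>In the coordinate \<open>u = - 1 / z\<close> the map becomes \<open>u \<mapsto> u\<^sup>2 / (u - 1) = u + 1 + 1 / (u - 1)\<close>.
  The correction \<open>- 2 Arg u\<close> is twice the imaginary part of the logarithm in the Fatou coordinate
  \<open>u - log u + \<dots>\<close>; the factor 2 leaves room for the error terms, so that the corrected height
  does not decrease along orbits.\<close>

lemma corrected_height_mono:
  assumes u: "2 \<le> Im u"
  defines "u' \<equiv> u + 1 + 1 / (u - 1)"
  shows "0 < Im u'" "Im u - 2 * Arg u \<le> Im u' - 2 * Arg u'" "Re u + 1 / 2 \<le> Re u'"
proof -
  define m where "m = norm (u - 1)"
  define n where "n = norm u"
  define \<tau> where "\<tau> = Arg (u - 1)"
  define \<theta> where "\<theta> = Arg u"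
  have m2: "2 \<le> m" using abs_Im_le_cmod[of "u - 1"] u by (simp add: m_def)
  have n2: "2 \<le> n" using abs_Im_le_cmod[of u] u by (simp add: n_def)
  have nm: "n \<le> 2 * m" using norm_triangle_ineq[of "u - 1" 1] m2 by (simp add: m_def n_def)
  have nz: "u - 1 \<noteq> 0" "u \<noteq> 0" using u by (auto simp: complex_eq_iff)
  have Im': "Im u' = Im u - Im u / m\<^sup>2"
    unfolding m_def cmod_power2 by (simp add: u'_def Im_divide)
  have "Im u / m\<^sup>2 < Im u"
    using u m2 by (auto simp: divide_less_eq intro!: one_less_power)
  then show "0 < Im u'" by (simp add: Im')
  have "Re (- (1 / (u - 1))) \<le> norm (- (1 / (u - 1)))" by (rule complex_Re_le_cmod)
  also have "\<dots> = 1 / m" by (simp add: m_def norm_divide)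
  also have "\<dots> \<le> 1 / 2" using m2 by (simp add: field_simps)
  finally show "Re u + 1 / 2 \<le> Re u'" by (simp add: u'_def)
  have \<theta>: "0 < \<theta>" "\<theta> < pi" and \<tau>: "0 < \<tau>" "\<tau> < pi"
    using u Arg_lt_pi[of u] Arg_lt_pi[of "u - 1"] by (simp_all add: \<theta>_def \<tau>_def)
  have polar: "u = rcis n \<theta>" "u - 1 = rcis m \<tau>"
    by (simp_all add: n_def m_def \<theta>_def \<tau>_def rcis_cmod_Arg)
  \<comment> \<open>This imaginary part equals \<open>Im u\<close> by direct expansion. Comparing
    with the polar form expresses the angle \<open>\<tau> - \<theta>\<close> through the
    height.\<close>
  have "Im ((u - 1) * cnj u) = Im (rcis m \<tau> * cnj (rcis n \<theta>))" by (simp flip: polar)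
  also have "\<dots> = m * n * sin (\<tau> - \<theta>)" by (simp add: sin_diff algebra_simps)
  finally have sin: "m * n * sin (\<tau> - \<theta>) = Im u" by (simp add: algebra_simps)
  then have "0 < sin (\<tau> - \<theta>)" using u m2 n2
    by (metis less_le_trans zero_less_numeral zero_less_mult_pos mult_pos_pos)
  then have "0 < \<tau> - \<theta>"
    using \<theta> \<tau> sin_ge_zero[of "\<theta> - \<tau>"] by (smt (verit) sin_minus)
  have "u' = u\<^sup>2 / (u - 1)" using nz by (simp add: u'_def field_simps power2_eq_square)
  also have "\<dots> = rcis (n\<^sup>2 / m) (2 * \<theta> - \<tau>)"
    unfolding polar(2) by (subst polar(1)) (simp add: DeMoivre2 rcis_divide)
  finally have u': "u' = rcis (n\<^sup>2 / m) (2 * \<theta> - \<tau>)" .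
  \<comment> \<open>The angle lies in the principal range: it is below \<open>\<theta>\<close> since
    \<open>\<theta> < \<tau>\<close>, and above \<open>- pi\<close> since
    \<open>\<tau> < pi\<close>. So \<open>Arg\<close> drops by exactly
    \<open>\<tau> - \<theta>\<close>.\<close>
  have "Arg u' = 2 * \<theta> - \<tau>"
    using m2 n2 \<theta> \<tau> \<open>0 < \<tau> - \<theta>\<close> u' by (intro Arg_unique'[of "n\<^sup>2 / m"]) auto
  \<comment> \<open>The left side is the height lost in one step, the right side the gain from the
    term \<open>- 2 * Arg\<close>.\<close>
  moreover have "Im u / m\<^sup>2 \<le> 2 * (\<tau> - \<theta>)"
  proof -
    have "Im u / m\<^sup>2 = n * sin (\<tau> - \<theta>) / m"
      using m2 by (simp add: sin[symmetric] power2_eq_square)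
    also have "\<dots> \<le> 2 * m * sin (\<tau> - \<theta>) / m"
      using nm \<open>0 < sin (\<tau> - \<theta>)\<close> m2 by (intro divide_right_mono mult_right_mono) auto
    also have "\<dots> = 2 * sin (\<tau> - \<theta>)" using m2 by simp
    finally show ?thesis using sin_x_le_x[of "\<tau> - \<theta>"] \<open>0 < \<tau> - \<theta>\<close> by simp
  qed
  ultimately show "Im u - 2 * Arg u \<le> Im u' - 2 * Arg u'"
    unfolding Im' \<theta>_def[symmetric] by simp
qed

text \<open>Since \<open>Arg\<close> is at most \<open>pi\<close>, the initial height
  \<open>2 + 2 * pi\<close> gives corrected height at least 2, which is preserved. In the upper
  half-plane \<open>Arg\<close> is positive, so the true height also stays at least 2 and the
  one-step estimate can be iterated.\<close>

lemma horodisc_orbit: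
  assumes u: "2 + 2 * pi \<le> Im (- 1 / z)"
  shows "2 \<le> Im (- 1 / (parabolic_map ^^ k) z)"
    and "Re (- 1 / (parabolic_map ^^ k) z) + 1 / 2 \<le> Re (- 1 / (parabolic_map ^^ Suc k) z)"
proof -
  define a where "a k = - 1 / (parabolic_map ^^ k) z" for k
  have step: "a (Suc k) = a k + 1 + 1 / (a k - 1)" if "2 \<le> Im (a k)" for k
  proof -
    define x where "x = (parabolic_map ^^ k) z"
    have x: "2 \<le> Im (- 1 / x)" using that by (simp add: a_def x_def)
    \<comment> \<open>Both excluded values make \<open>- 1 / x\<close> real: division by zero gives
      0, and \<open>x = - 1\<close> gives 1.\<close>
    have "x \<noteq> 0" "1 + x \<noteq> 0"
      using x by (auto simp: add_eq_0_iff)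
    then have "parabolic_map x \<noteq> 0"
      by (simp add: parabolic_map_def power2_eq_square)
        (metis distrib_left mult.right_neutral mult_eq_0_iff)
    then have "- 1 / parabolic_map x = - 1 / x + 1 / (1 + x)"
      using \<open>x \<noteq> 0\<close> by (intro parabolic_map_inverse_coordinate)
    moreover have "1 / (- 1 / x - 1) = - x / (1 + x)"
    proof -
      have "- 1 / x - 1 = - (1 + x) / x" using \<open>x \<noteq> 0\<close> by (simp add: field_simps)
      then have "1 / (- 1 / x - 1) = x / (- (1 + x))" by simp
      also have "\<dots> = - x / (1 + x)" using minus_divide_right[of x "1 + x"] by simp
      finally show ?thesis .
    qed
    moreover have "1 / (1 + x) = 1 + - x / (1 + x)"
      using \<open>1 + x \<noteq> 0\<close> by (simp add: field_simps)
    ultimately show ?thesis by (simp add: a_def x_def)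
  qed
  have inv: "0 < Im (a k) \<and> 2 \<le> Im (a k) - 2 * Arg (a k)" for k
  proof (induction k)
    case 0
    have "Arg (a 0) \<le> pi" by (rule Arg_le_pi)
    moreover have "a 0 = - 1 / z" by (simp add: a_def)
    moreover have "0 < Im (a 0)" using u pi_gt_zero unfolding \<open>a 0 = - 1 / z\<close> by linarith
    ultimately show ?case using u by simp
  next
    case (Suc k)
    then have "0 < Arg (a k)" by (simp add: Arg_pos_iff)
    with Suc have "2 \<le> Im (a k)" by simp
    then show ?case
      using corrected_height_mono(1,2)[of "a k"] step[of k] Suc by force
  qed
  have ge2: "2 \<le> Im (a k)" for k
  proof -
    have "0 < Arg (a k)" using inv[of k] by (simp add: Arg_pos_iff)
    then show ?thesis using inv[of k] by linarith
  qed
  from ge2[of k] show "2 \<le> Im (- 1 / (parabolic_map ^^ k) z)" by (simp add: a_def)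
  from corrected_height_mono(3)[OF ge2, of k] step[OF ge2, of k]
  show "Re (- 1 / (parabolic_map ^^ k) z) + 1 / 2 \<le> Re (- 1 / (parabolic_map ^^ Suc k) z)"
    by (simp add: a_def)
qed

lemma horodisc_subset_basin:
  assumes "2 + 2 * pi \<le> Im (- 1 / z)"
  shows "z \<in> parabolic_basin parabolic_map 0 (- 1)"
proof (rule in_parabolic_basin)
  show "(parabolic_map ^^ k) z \<noteq> 0" for k
    using horodisc_orbit(1)[OF assms, of k] by auto
qed (rule horodisc_orbit(2)[OF assms])

text \<open>Along an orbit starting in the horodisc \<open>- 1 / z\<close> is never real, so that
  orbit cannot meet the real orbit of \<open>- 1 / 2\<close>.\<close>

lemma critical_grand_orbit_avoids_horodisc:
  assumes "(parabolic_map ^^ l) q = (parabolic_map ^^ k) (- (1 / 2))"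
  shows "Im (- 1 / q) < 2 + 2 * pi"
proof (rule ccontr)
  assume "\<not> ?thesis"
  then have "2 \<le> Im (- 1 / (parabolic_map ^^ l) q)" by (intro horodisc_orbit) simp
  moreover obtain y where "(parabolic_map ^^ k) (- (1/2)) = of_real y"
    using parabolic_orbit_real[of "- 1 / 2" k] by auto
  ultimately show False using assms by simp
qed

section \<open>Choice of the base point and conclusion\<close>

theorem theoremA:
  fixes C :: real
  assumes "C > 0"
  shows "- (1/2) \<in> parabolic_basin parabolic_map 0 (-1) \<and>
    (\<exists>z\<^sub>0 \<in> parabolic_basin parabolic_map 0 (-1).
      \<forall>q \<in> (\<Union>l. \<Union>k. (parabolic_map ^^ l) -` {(parabolic_map ^^ k) (- (1/2))}).
        kobayashi_dist (parabolic_basin parabolic_map 0 (-1)) z\<^sub>0 q \<ge> ennreal C)"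
proof (intro conjI minus_half_in_basin)
  define A where "A = parabolic_basin parabolic_map 0 (- 1)"
  define U :: "complex set" where "U = - \<real>\<^sub>\<ge>\<^sub>0"
  define W where "W z = csqrt (- 1 / z)" for z
  define E where "E = exp (2 * C)"
  \<comment> \<open>Distance less than \<open>C\<close> from \<open>1 + i b\<close> will give
    \<open>Re (W q) \<ge> 1 / E\<close> and \<open>Im (W q) \<ge> b - 2 * C * E\<close>. This
    \<open>b\<close> makes the product of the two lower bounds equal to \<open>1 + pi\<close>, which
    is half the horodisc height.\<close>
  define b where "b = 2 * C * E + (1 + pi) * E"
  define z where "z = - 1 / (Complex 1 b)\<^sup>2"
  have E: "1 \<le> E" using assms by (simp add: E_def)
  have AU: "A \<subseteq> U" using parabolic_basin_avoids_nonneg by (auto simp: A_def U_def)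
  have slit: "- 1 / w \<notin> \<real>\<^sub>\<le>\<^sub>0" if "w \<in> U" for w
  proof
    assume "- 1 / w \<in> \<real>\<^sub>\<le>\<^sub>0"
    then obtain r where "r \<le> 0" "- 1 / w = of_real r" by (rule nonpos_Reals_cases)
    moreover have "w = - 1 / (- 1 / w)" by simp
    ultimately have w: "w = of_real (- 1 / r)" by simp
    have "w \<in> \<real>\<^sub>\<ge>\<^sub>0"
      unfolding w nonneg_Reals_of_real_iff using \<open>r \<le> 0\<close> by (intro divide_nonpos_nonpos) auto
    with that show False by (simp add: U_def)
  qed
  have W: "W holomorphic_on U"
    unfolding W_def
  proof (rule holomorphic_on_csqrt'[OF _ slit])
    show "(\<lambda>z. - 1 / z) holomorphic_on U"
      by (intro holomorphic_on_divide holomorphic_on_const holomorphic_on_ident) (auto simp: U_def)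
  qed
  have U: "open U" by (simp add: U_def open_Compl)
  have Wsq: "(W w)\<^sup>2 = - 1 / w" for w by (simp only: W_def power2_csqrt)
  \<comment> \<open>The principal root has nonnegative real part. If that part were zero, its square
    \<open>- 1 / w\<close> would lie on the excluded slit.\<close>
  have pos: "0 < Re (W w)" if "w \<in> U" for w
  proof (rule ccontr)
    assume "\<not> ?thesis"
    then have "Re (W w) = 0" using Re_csqrt[of "- 1 / w"] by (simp only: W_def)
    then have "(W w)\<^sup>2 = of_real (- (Im (W w))\<^sup>2)"
      by (simp add: complex_eq_iff power2_eq_square)
    then have "(W w)\<^sup>2 \<in> \<real>\<^sub>\<le>\<^sub>0" by (simp only: nonpos_Reals_of_real_iff) simp
    with slit[OF that] show False by (simp only: Wsq)
  qed
  have u: "- 1 / z = (Complex 1 b)\<^sup>2" by (simp add: z_def)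
  have Wz: "W z = Complex 1 b" unfolding W_def u by (intro csqrt_square) simp
  have "0 \<le> 2 * C * E" "1 + pi \<le> (1 + pi) * E"
    using assms E pi_gt_zero mult_left_mono[of 1 E "1 + pi"] by simp_all
  then have "1 + pi \<le> b" unfolding b_def by linarith
  then have "2 + 2 * pi \<le> Im (- 1 / z)" unfolding u by (simp add: power2_eq_square)
  then have zA: "z \<in> A" unfolding A_def by (rule horodisc_subset_basin)
  have "ennreal C \<le> kobayashi_dist A z q"
    if q: "(parabolic_map ^^ l) q = (parabolic_map ^^ k) (- (1/2))" for l k q
  proof (rule ccontr)
    assume "\<not> ?thesis"
    then have dist: "kobayashi_dist A z q < ennreal C" by simp
    have x: "1 / E \<le> Re (W q)"
      using kobayashi_dist_half_plane(1)[OF W U AU pos dist assms]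
      by (simp add: Wz E_def exp_minus inverse_eq_divide)
    have y: "(1 + pi) * E \<le> Im (W q)"
      using kobayashi_dist_half_plane(2)[OF W U AU pos dist assms]
      by (simp add: Wz E_def b_def)
    \<comment> \<open>Twice this product is the imaginary part of
      \<open>(W q)\<^sup>2 = - 1 / q\<close>, so \<open>q\<close> would lie in the horodisc.\<close>
    have "1 / E * ((1 + pi) * E) \<le> Re (W q) * Im (W q)"
      using x y E pi_gt_zero by (intro mult_mono) (auto intro: order_trans[OF _ x])
    moreover have "Im ((W q)\<^sup>2) = 2 * (Re (W q) * Im (W q))"
      by (simp add: power2_eq_square)
    ultimately have "2 + 2 * pi \<le> Im ((W q)\<^sup>2)" using E by simp
    then show False
      using critical_grand_orbit_avoids_horodisc[OF q] by (simp add: Wsq)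
  qed
  then show "\<exists>z\<^sub>0 \<in> parabolic_basin parabolic_map 0 (-1).
      \<forall>q \<in> (\<Union>l. \<Union>k. (parabolic_map ^^ l) -` {(parabolic_map ^^ k) (- (1/2))}).
        kobayashi_dist (parabolic_basin parabolic_map 0 (-1)) z\<^sub>0 q \<ge> ennreal C"
    using zA unfolding A_def by (intro bexI[of _ z]) auto
qed

end
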